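(* Let $R$ be a commutative ring with unity. Then $R$ is reduced of dimension zero if and only if $f\in (f^2)$ for every element $f\in R$. In particular, if $R$ is Noetherian, then the condition that $f\in(f^2)$ for every $f\in R$ is equivalent to $R$ being a finite direct product of fields.
   Context: Here $(f^2)$ is the principal ideal of $R$ generated by $f^2$. "Dimension zero" means that every prime ideal of $R$ is maximal (so the trivial zero ring, which is the empty product of fields, is not excluded). *)

theory Defs
  imports "HOL-Algebra.Algebra"
begin

text \<open>For \<open>n = 0\<close> the hypothesis reads \<open>\<one> = \<zero>\<close>, which only holds in the zero ring, so there is
  no need to restrict the exponent to positive numbers.\<close>

definition reduced_ring :: "('a, 'm) ring_scheme \<Rightarrow> bool"
  where "reduced_ring R \<longleftrightarrow>
    (\<forall>x\<in>carrier R. (\<exists>n::nat. x [^]\<^bsub>R\<^esub> n = \<zero>\<^bsub>R\<^esub>) \<longrightarrow> x = \<zero>\<^bsub>R\<^esub>)"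

definition zero_dimensional :: "('a, 'm) ring_scheme \<Rightarrow> bool"
  where "zero_dimensional R \<longleftrightarrow> (\<forall>P. primeideal P R \<longrightarrow> maximalideal P R)"

text \<open>The empty product is allowed: \<^term>\<open>RDirProd_list []\<close> is the zero ring. An existential
  quantifier in HOL cannot range over types, so the factors are required to have their carriers in
  the element type of \<open>R\<close>. This excludes nothing, because every factor injects into the product;
  the lemma \<open>finite_product_of_fieldsI\<close> below shows that factors over an arbitrary type may be
  used.\<close>

definition finite_product_of_fields :: "('a, 'm) ring_scheme \<Rightarrow> bool"
  where "finite_product_of_fields R \<longleftrightarrow>
    (\<exists>Fs :: 'a ring list. (\<forall>F\<in>set Fs. field F) \<and> R \<simeq> RDirProd_list Fs)"

lemma RDirProd_list_cong_iso:
  assumes "list_all2 (\<lambda>F G. F \<simeq> G) Fs Gs"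
  shows "RDirProd_list Fs \<simeq> RDirProd_list Gs"
  using assms
proof (induction rule: list_all2_induct)
  case Nil
  show ?case
    unfolding is_ring_iso_def ring_iso_def ring_hom_def
    by (auto simp: monoid.defs intro!: exI[of _ "\<lambda>x. []"] bij_betwI[where g = "\<lambda>x. []"])
next
  case (Cons F Fs G Gs)
  from Cons.hyps obtain f where f: "f \<in> ring_iso F G"
    unfolding is_ring_iso_def by blast
  from Cons.IH obtain g where g: "g \<in> ring_iso (RDirProd_list Fs) (RDirProd_list Gs)"
    unfolding is_ring_iso_def by blast
  show ?case
    using ring_iso_set_trans[OF ring_iso_set_trans[OF RDirProd_list_iso2 RDirProd_iso6[OF f g]]
        RDirProd_list_iso1]
    unfolding is_ring_iso_def by blast
qed

lemma finite_product_of_fieldsI: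
  fixes R :: "('a, 'm) ring_scheme" and Fs :: "'b ring list"
  assumes fields: "\<And>F. F \<in> set Fs \<Longrightarrow> field F" and iso: "R \<simeq> RDirProd_list Fs"
  shows "finite_product_of_fields R"
proof -
  from iso obtain h where h: "h \<in> ring_iso R (RDirProd_list Fs)"
    unfolding is_ring_iso_def by blast
  hence bij: "bij_betw h (carrier R) (carrier (RDirProd_list Fs))"
    unfolding ring_iso_def by blast
  define zs where "zs = map ring.zero Fs"
  define e where "e i x = inv_into (carrier R) h (zs[i := x])" for i x
  have inj: "inj_on (e i) (carrier (Fs ! i))" if i: "i < length Fs" for i
  proof (rule inj_onI)
    fix x y assume xy: "x \<in> carrier (Fs ! i)" "y \<in> carrier (Fs ! i)" "e i x = e i y"
    have mem: "zs[i := z] \<in> carrier (RDirProd_list Fs)" if z: "z \<in> carrier (Fs ! i)" for z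
    proof (rule RDirProd_list_carrier_memI)
      fix j assume "j < length Fs"
      moreover from this have "ring (Fs ! j)"
        using fields[of "Fs ! j"] by (simp add: field_def domain_def cring_def)
      ultimately show "zs[i := z] ! j \<in> carrier (Fs ! j)"
        using z by (cases "i = j") (auto simp: zs_def intro: ring.ring_simprules)
    qed (simp add: zs_def)
    have "zs[i := x] = zs[i := y]"
      using inj_onD[OF inj_on_inv_into[of "carrier (RDirProd_list Fs)" h "carrier R"]]
        bij mem xy unfolding e_def bij_betw_def by blast
    hence "zs[i := x] ! i = zs[i := y] ! i"
      by simp
    thus "x = y"
      using i by (simp add: zs_def)
  qed
  define Gs where "Gs = map (\<lambda>i. image_ring (e i) (Fs ! i)) [0..<length Fs]"
  have "field G" if "G \<in> set Gs" for G
  proof -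
    from that obtain i where i: "i < length Fs" and G: "G = image_ring (e i) (Fs ! i)"
      unfolding Gs_def by auto
    show ?thesis
      unfolding G using field.inj_imp_image_ring_is_field[OF fields inj[OF i]] i by simp
  qed
  moreover have "list_all2 (\<lambda>F G. F \<simeq> G) Fs Gs"
    unfolding list_all2_conv_all_nth Gs_def is_ring_iso_def
    using inj_imp_image_ring_iso[OF inj] by fastforce
  from RDirProd_list_cong_iso[OF this] have "R \<simeq> RDirProd_list Gs"
    using ring_iso_set_trans[OF h] unfolding is_ring_iso_def by blast
  ultimately show ?thesis
    unfolding finite_product_of_fields_def by blast
qed

end

theory Submission
  imports Defs
begin

text \<open>
  The condition \<open>f \<in> (f\<^sup>2)\<close> says that \<open>f = x f\<^sup>2\<close> for some \<open>x\<close>, that is, \<open>f (1 - x f) = 0\<close>: the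
  commutative form of von Neumann regularity.

  Regularity gives the other two properties at once. Substituting \<open>f = x f\<^sup>2\<close> into itself gives
  \<open>f = x\<^sup>n f\<^sup>n\<^sup>+\<^sup>1\<close>, so a nilpotent element vanishes; and \<open>f (1 - x f) = 0\<close> lies in every prime ideal
  \<open>P\<close>, so an \<open>f\<close> outside \<open>P\<close> is invertible modulo \<open>P\<close>. Conversely, fix \<open>f\<close> in a reduced
  zero-dimensional ring and consider the multiplicative set of all \<open>f\<^sup>n (1 - x f)\<close>. If it
  avoided \<open>0\<close>, then some prime ideal \<open>P\<close> would avoid it (\<open>exists_primeideal_disjoint\<close>); but \<open>P\<close>
  is maximal and \<open>f \<notin> P\<close>, so \<open>P\<close> contains some \<open>1 - x f\<close>, a contradiction. Hence
  \<open>f\<^sup>n (1 - x f) = 0\<close> for some \<open>n\<close> and \<open>x\<close>; then \<open>f (1 - x f)\<close> is nilpotent, hence zero.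

  In a regular ring every ideal is radical: \<open>a\<^sup>2 \<in> I\<close> implies \<open>a \<in> I\<close>. Noetherian induction then
  writes every ideal as a finite intersection of maximal ideals
  (\<open>ideal_finite_Inter_maximalideals\<close>), because an ideal \<open>I\<close> that is neither the whole ring nor
  prime contains some \<open>a b\<close> with \<open>a, b \<notin> I\<close>, and then \<open>I = (I + (a)) \<inter> (I + (b))\<close>:
  the square of an element of the right-hand side is a product of an element of \<open>I + (a)\<close> and one
  of \<open>I + (b)\<close>, so it lies in \<open>I\<close>. For the zero ideal, the Chinese remainder theorem turns this into a finite product of fields. In the other
  direction, fields are regular, and regularity passes to products and isomorphic copies.
\<close>

section \<open>Ideals in commutative rings\<close>

lemma (in ring) subset_add_ideals:
  assumes "ideal I R" "ideal J R"
  shows "I \<subseteq> I <+>\<^bsub>R\<^esub> J" and "J \<subseteq> I <+>\<^bsub>R\<^esub> J"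
proof -
  interpret I: ideal I R by fact
  interpret J: ideal J R by fact
  show "I \<subseteq> I <+>\<^bsub>R\<^esub> J"
  proof
    fix x assume "x \<in> I"
    then have "x = x \<oplus> \<zero>" "x \<in> I" "\<zero> \<in> J"
      using I.Icarr J.zero_closed by auto
    then show "x \<in> I <+>\<^bsub>R\<^esub> J"
      unfolding set_add_def' by blast
  qed
  show "J \<subseteq> I <+>\<^bsub>R\<^esub> J"
  proof
    fix x assume "x \<in> J"
    then have "x = \<zero> \<oplus> x" "x \<in> J" "\<zero> \<in> I"
      using J.Icarr I.zero_closed by auto
    then show "x \<in> I <+>\<^bsub>R\<^esub> J"
      unfolding set_add_def' by blast
  qed
qed

lemma (in cring) subset_add_PIdl:
  assumes "ideal I R" "a \<in> carrier R"
  shows "I \<subseteq> I <+>\<^bsub>R\<^esub> PIdl a" and "a \<in> I <+>\<^bsub>R\<^esub> PIdl a"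
  using subset_add_ideals[OF assms(1) cgenideal_ideal[OF assms(2)]] cgenideal_self[OF assms(2)]
  by blast+

lemma (in cring) add_PIdl_memE:
  assumes "z \<in> I <+>\<^bsub>R\<^esub> PIdl a"
  obtains p r where "p \<in> I" "r \<in> carrier R" "z = p \<oplus> r \<otimes> a"
  using assms unfolding set_add_def' cgenideal_def by auto

text \<open>Every term of \<open>(p + r a) (q + u b)\<close> has \<open>p\<close>, \<open>q\<close> or \<open>a b\<close> as a factor.\<close>

lemma (in cring) add_PIdl_mult_mem:
  assumes I: "ideal I R" and a: "a \<in> carrier R" and b: "b \<in> carrier R" and ab: "a \<otimes> b \<in> I"
    and s: "s \<in> I <+>\<^bsub>R\<^esub> PIdl a" and t: "t \<in> I <+>\<^bsub>R\<^esub> PIdl b"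
  shows "s \<otimes> t \<in> I"
proof -
  interpret ideal I R by fact
  obtain p r where p: "p \<in> I" "r \<in> carrier R" "s = p \<oplus> r \<otimes> a"
    using s by (rule add_PIdl_memE)
  obtain q u where q: "q \<in> I" "u \<in> carrier R" "t = q \<oplus> u \<otimes> b"
    using t by (rule add_PIdl_memE)
  have pq: "p \<in> carrier R" "q \<in> carrier R"
    using p q Icarr by auto
  have "s \<otimes> t = (p \<otimes> t \<oplus> (r \<otimes> a) \<otimes> q) \<oplus> (r \<otimes> u) \<otimes> (a \<otimes> b)"
    unfolding p(3) q(3) using pq p(2) q(2) a b by algebra
  moreover have "t \<in> carrier R"
    using q pq b by simp
  ultimately show ?thesis
    using p q pq a b ab I_l_closed I_r_closed by simp
qed

lemma (in cring) maximalideal_inverse_mod: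
  assumes M: "maximalideal M R" and a: "a \<in> carrier R" "a \<notin> M"
  obtains x where "x \<in> carrier R" "\<one> \<ominus> x \<otimes> a \<in> M"
proof -
  interpret maximalideal M R by fact
  have J: "ideal (M <+>\<^bsub>R\<^esub> PIdl a) R"
    using add_ideals[OF is_ideal cgenideal_ideal] a by blast
  have "M <+>\<^bsub>R\<^esub> PIdl a = carrier R"
    using I_maximal[OF J] subset_add_PIdl[OF is_ideal a(1)] a(2) additive_subgroup.a_subset
      ideal.axioms(1)[OF J] by blast
  then have "\<one> \<in> M <+>\<^bsub>R\<^esub> PIdl a"
    by simp
  then obtain p x where px: "p \<in> M" "x \<in> carrier R" "\<one> = p \<oplus> x \<otimes> a"
    by (rule add_PIdl_memE)
  have "p \<in> carrier R"
    using px(1) Icarr by blast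
  then have "\<one> \<ominus> x \<otimes> a = p"
    unfolding px(3) using px(2) a(1) by algebra
  with px show thesis
    using that by simp
qed

text \<open>Zorn's lemma applies to the ideals disjoint from \<open>S\<close>, among them the zero ideal. A maximal one,
  \<open>P\<close>, is prime: if \<open>a, b \<notin> P\<close>, then \<open>P + (a)\<close> and
  \<open>P + (b)\<close> both meet \<open>S\<close>, and the product of the two elements found lies in \<open>S\<close>. It would lie
  in \<open>P\<close> as well if \<open>a b \<in> P\<close>.\<close>

lemma (in cring) exists_primeideal_disjoint:
  assumes S: "submonoid S R" and zero: "\<zero> \<notin> S"
  obtains P where "primeideal P R" "P \<inter> S = {}"
proof -
  interpret S: submonoid S R by fact
  define A where "A = {I. ideal I R \<and> I \<inter> S = {}}"
  have "\<exists>P\<in>A. \<forall>J\<in>A. P \<subseteq> J \<longrightarrow> J = P"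
  proof (rule subset_Zorn_nonempty)
    have "{\<zero>} \<in> A"
      unfolding A_def using zeroideal zero by auto
    then show "A \<noteq> {}" by blast
  next
    fix C assume C: "C \<noteq> {}" "subset.chain A C"
    then have "subset.chain {I. ideal I R} C"
      unfolding pred_on.chain_def A_def by blast
    from chain_Union_is_ideal[OF this] C show "\<Union>C \<in> A"
      unfolding A_def pred_on.chain_def by auto
  qed
  then obtain P where "P \<in> A" and maxA: "\<forall>J\<in>A. P \<subseteq> J \<longrightarrow> J = P"
    by blast
  then have P: "ideal P R" "P \<inter> S = {}"
    unfolding A_def by auto
  have meets: "\<exists>s\<in>S. s \<in> P <+>\<^bsub>R\<^esub> PIdl a" if a: "a \<in> carrier R" "a \<notin> P" for a
  proof (rule ccontr)
    assume "\<not> (\<exists>s\<in>S. s \<in> P <+>\<^bsub>R\<^esub> PIdl a)"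
    then have "P <+>\<^bsub>R\<^esub> PIdl a \<in> A"
      unfolding A_def using add_ideals[OF P(1) cgenideal_ideal[OF a(1)]] by auto
    then have "P <+>\<^bsub>R\<^esub> PIdl a = P"
      using maxA subset_add_PIdl(1)[OF P(1) a(1)] by simp
    then show False
      using subset_add_PIdl(2)[OF P(1) a(1)] a(2) by simp
  qed
  have "primeideal P R"
  proof (rule primeidealI[OF P(1) is_cring])
    show "carrier R \<noteq> P"
      using P(2) S.one_closed by auto
  next
    fix a b assume ab: "a \<in> carrier R" "b \<in> carrier R" "a \<otimes> b \<in> P"
    show "a \<in> P \<or> b \<in> P"
    proof (rule ccontr)
      assume "\<not> (a \<in> P \<or> b \<in> P)"
      then obtain s t where "s \<in> S" "s \<in> P <+>\<^bsub>R\<^esub> PIdl a" "t \<in> S" "t \<in> P <+>\<^bsub>R\<^esub> PIdl b"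
        using meets ab by meson
      then show False
        using add_PIdl_mult_mem[OF P(1) ab] P(2) S.m_closed by blast
    qed
  qed
  then show thesis
    using that P(2) by blast
qed

lemma (in noetherian_ring) exists_maximal_in_ideal_set:
  assumes "A \<noteq> {}" "\<And>I. I \<in> A \<Longrightarrow> ideal I R"
  obtains I where "I \<in> A" "\<And>J. J \<in> A \<Longrightarrow> I \<subseteq> J \<Longrightarrow> J = I"
proof -
  have "\<exists>I\<in>A. \<forall>J\<in>A. I \<subseteq> J \<longrightarrow> J = I"
  proof (rule subset_Zorn_nonempty[OF assms(1)])
    fix C assume C: "C \<noteq> {}" "subset.chain A C"
    have "A \<subseteq> {I. ideal I R}"
      using assms(2) by auto
    with C(2) have "subset.chain {I. ideal I R} C"
      unfolding pred_on.chain_def by (meson subset_trans)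
    from ideal_chain_is_trivial[OF C(1) this] C(2) show "\<Union>C \<in> A"
      unfolding pred_on.chain_def by auto
  qed
  then show thesis
    using that by blast
qed

section \<open>Von Neumann regularity\<close>

text \<open>In a commutative ring, \<open>x f\<^sup>2\<close> is the \<open>f x f\<close> of the usual definition.\<close>

definition von_neumann_regular :: "('a, 'm) ring_scheme \<Rightarrow> bool"
  where "von_neumann_regular R \<longleftrightarrow>
    (\<forall>f\<in>carrier R. \<exists>x\<in>carrier R. f = x \<otimes>\<^bsub>R\<^esub> (f \<otimes>\<^bsub>R\<^esub> f))"

lemma (in ring) von_neumann_regular_iff_mem_PIdl_square:
  "von_neumann_regular R \<longleftrightarrow> (\<forall>f\<in>carrier R. f \<in> PIdl (f [^] (2::nat)))"
proof -
  have "(\<exists>x\<in>carrier R. f = x \<otimes> (f \<otimes> f)) \<longleftrightarrow> f \<in> PIdl (f [^] (2::nat))"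
    if "f \<in> carrier R" for f
    using that by (auto simp: cgenideal_def numeral_2_eq_2)
  then show ?thesis
    unfolding von_neumann_regular_def by simp
qed

lemma (in cring) von_neumann_regular_imp_reduced:
  assumes reg: "von_neumann_regular R"
  shows "reduced_ring R"
  unfolding reduced_ring_def
proof (intro ballI impI, elim exE)
  fix f and n :: nat assume f: "f \<in> carrier R" and nil: "f [^] n = \<zero>"
  obtain x where x: "x \<in> carrier R" "f = x \<otimes> (f \<otimes> f)"
    using reg f unfolding von_neumann_regular_def by blast
  have "f = x [^] m \<otimes> (f [^] m \<otimes> f)" for m :: nat
  proof (induction m)
    case 0
    show ?case using f by simp
  next
    case (Suc m)
    have "f = x [^] m \<otimes> (f [^] m \<otimes> (x \<otimes> (f \<otimes> f)))"
      using Suc x(2) by simp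
    also have "\<dots> = x [^] Suc m \<otimes> (f [^] Suc m \<otimes> f)"
      using f x(1) by (simp add: m_ac)
    finally show ?case .
  qed
  \<comment> \<open>The formula contains \<open>f\<^sup>n\<close> as a factor, also in the degenerate case \<open>n = 0\<close>.\<close>
  from this[of n] show "f = \<zero>"
    using nil f x(1) by simp
qed

lemma (in cring) von_neumann_regular_imp_zero_dimensional:
  assumes reg: "von_neumann_regular R"
  shows "zero_dimensional R"
  unfolding zero_dimensional_def
proof (intro allI impI)
  fix P assume "primeideal P R"
  then interpret P: primeideal P R .
  show "maximalideal P R"
  proof (rule maximalidealI[OF P.is_ideal P.I_notcarr])
    fix J assume J: "ideal J R" "P \<subseteq> J" "J \<subseteq> carrier R"
    interpret J: ideal J R by fact
    show "J = P \<or> J = carrier R"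
    proof (rule disjCI)
      assume "J \<noteq> carrier R"
      moreover have "J = carrier R" if a: "a \<in> J" "a \<notin> P" for a
      proof -
        have ac: "a \<in> carrier R" using a J by blast
        obtain x where x: "x \<in> carrier R" "a = x \<otimes> (a \<otimes> a)"
          using reg ac unfolding von_neumann_regular_def by blast
        have "a \<otimes> (\<one> \<ominus> x \<otimes> a) = a \<ominus> x \<otimes> (a \<otimes> a)"
          using ac x(1) by algebra
        also have "\<dots> = \<zero>"
          using x(2) ac by (metis r_right_minus_eq)
        finally have "a \<otimes> (\<one> \<ominus> x \<otimes> a) \<in> P"
          using P.zero_closed by simp
        moreover have "\<one> \<ominus> x \<otimes> a \<in> carrier R"
          using ac x(1) by simp
        ultimately have "\<one> \<ominus> x \<otimes> a \<in> P"
          using P.I_prime[OF ac] a(2) by blast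
        then have "\<one> \<ominus> x \<otimes> a \<in> J" "x \<otimes> a \<in> J"
          using J(2) J.I_l_closed[OF a(1) x(1)] by auto
        then have "(\<one> \<ominus> x \<otimes> a) \<oplus> x \<otimes> a \<in> J"
          by (rule J.a_closed)
        moreover have "(\<one> \<ominus> x \<otimes> a) \<oplus> x \<otimes> a = \<one>"
          using ac x(1) by algebra
        ultimately show ?thesis
          using J.one_imp_carrier by simp
      qed
      ultimately show "J = P"
        using J(2) by blast
    qed
  qed
qed

text \<open>The elements \<open>1 - x f\<close> are those congruent to \<open>1\<close> modulo \<open>(f)\<close>, so they are closed under
  multiplication. A maximal ideal without \<open>f\<close> contains one of them, whereas a prime ideal avoiding
  the whole set omits \<open>f\<close>; together these force \<open>0\<close> into the set when primes are maximal.\<close>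

lemma (in cring) submonoid_power_times_one_minus:
  assumes f: "f \<in> carrier R"
  shows "submonoid {f [^] (n::nat) \<otimes> (\<one> \<ominus> x \<otimes> f) | n x. x \<in> carrier R} R" (is "submonoid ?S R")
proof
  show "?S \<subseteq> carrier R"
    using f by auto
  have "\<one> = f [^] (0::nat) \<otimes> (\<one> \<ominus> \<zero> \<otimes> f)"
    using f by (simp add: minus_eq)
  then show "\<one> \<in> ?S"
    by blast
  fix s t assume "s \<in> ?S" "t \<in> ?S"
  then obtain m n :: nat and x y where *: "x \<in> carrier R" "y \<in> carrier R"
    "s = f [^] m \<otimes> (\<one> \<ominus> x \<otimes> f)" "t = f [^] n \<otimes> (\<one> \<ominus> y \<otimes> f)"
    by blast
  have "s \<otimes> t = (f [^] m \<otimes> f [^] n) \<otimes> ((\<one> \<ominus> x \<otimes> f) \<otimes> (\<one> \<ominus> y \<otimes> f))"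
    unfolding *(3,4) using * f by (simp add: m_ac)
  also have "(\<one> \<ominus> x \<otimes> f) \<otimes> (\<one> \<ominus> y \<otimes> f) = \<one> \<ominus> (x \<oplus> y \<ominus> x \<otimes> y \<otimes> f) \<otimes> f"
    using *(1,2) f by algebra
  finally have "s \<otimes> t = f [^] (m + n) \<otimes> (\<one> \<ominus> (x \<oplus> y \<ominus> x \<otimes> y \<otimes> f) \<otimes> f)"
    using f by (simp add: nat_pow_mult)
  then show "s \<otimes> t \<in> ?S"
    using * f by blast
qed

lemma (in cring) reduced_zero_dimensional_imp_von_neumann_regular:
  assumes red: "reduced_ring R" and dim: "zero_dimensional R"
  shows "von_neumann_regular R"
  unfolding von_neumann_regular_def
proof
  fix f assume f: "f \<in> carrier R"
  define S where "S = {f [^] (n::nat) \<otimes> (\<one> \<ominus> x \<otimes> f) | n x. x \<in> carrier R}"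
  have "\<zero> \<in> S"
  proof (rule ccontr)
    assume "\<zero> \<notin> S"
    have "submonoid S R"
      unfolding S_def by (rule submonoid_power_times_one_minus[OF f])
    then obtain P where P: "primeideal P R" "P \<inter> S = {}"
      using \<open>\<zero> \<notin> S\<close> by (rule exists_primeideal_disjoint)
    have "f = f [^] (1::nat) \<otimes> (\<one> \<ominus> \<zero> \<otimes> f)"
      using f by (simp add: minus_eq)
    then have "f \<in> S"
      unfolding S_def by blast
    with P(2) have "f \<notin> P"
      by blast
    moreover have "maximalideal P R"
      using dim P(1) unfolding zero_dimensional_def by blast
    ultimately obtain x where x: "x \<in> carrier R" "\<one> \<ominus> x \<otimes> f \<in> P"
      using maximalideal_inverse_mod f by blast
    have "\<one> \<ominus> x \<otimes> f = f [^] (0::nat) \<otimes> (\<one> \<ominus> x \<otimes> f)"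
      using f x(1) by simp
    then have "\<one> \<ominus> x \<otimes> f \<in> S"
      unfolding S_def using x(1) by blast
    with x(2) P(2) show False
      by blast
  qed
  then obtain n :: nat and x where x: "x \<in> carrier R" and 0: "f [^] n \<otimes> (\<one> \<ominus> x \<otimes> f) = \<zero>"
    unfolding S_def by force
  define e where "e = \<one> \<ominus> x \<otimes> f"
  have e: "e \<in> carrier R"
    unfolding e_def using x f by simp
  \<comment> \<open>Multiplying the equation by \<open>e\<^sup>n f\<close> makes it a power of \<open>f e\<close>.\<close>
  have "(f \<otimes> e) [^] Suc n = (f [^] n \<otimes> e) \<otimes> (e [^] n \<otimes> f)"
    using f e by (simp add: nat_pow_distrib m_ac)
  also have "\<dots> = \<zero>"
    using 0 f e unfolding e_def by simp
  finally have "f \<otimes> e = \<zero>"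
    using red f e unfolding reduced_ring_def by blast
  moreover have "f \<otimes> e = f \<ominus> x \<otimes> (f \<otimes> f)"
    unfolding e_def using f x by algebra
  ultimately have "f = x \<otimes> (f \<otimes> f)"
    using f x by simp
  then show "\<exists>x\<in>carrier R. f = x \<otimes> (f \<otimes> f)"
    using x by blast
qed

section \<open>Noetherian regular rings\<close>

text \<open>A counterexample maximal under inclusion is neither the whole ring nor maximal, hence not
  prime, since regular rings are zero-dimensional; regularity then makes it the intersection of two
  strictly larger ideals. Intersecting with the carrier lets the whole ring be the intersection of no maximal
  ideals, since \<open>\<Inter>{}\<close> is the whole type.\<close>

lemma (in cring) ideal_finite_Inter_maximalideals:
  assumes noeth: "noetherian_ring R" and reg: "von_neumann_regular R" and I: "ideal I R"
  obtains Ms where "finite Ms" "\<And>M. M \<in> Ms \<Longrightarrow> maximalideal M R" "I = carrier R \<inter> \<Inter>Ms"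
proof -
  define good where
    "good I \<longleftrightarrow> (\<exists>Ms. finite Ms \<and> (\<forall>M\<in>Ms. maximalideal M R) \<and> I = carrier R \<inter> \<Inter>Ms)" for I
  have "good I"
  proof (rule ccontr)
    assume "\<not> good I"
    then have ne: "{K. ideal K R \<and> \<not> good K} \<noteq> {}"
      using I by blast
    obtain K where "K \<in> {K. ideal K R \<and> \<not> good K}"
      and max': "\<And>J. J \<in> {K. ideal K R \<and> \<not> good K} \<Longrightarrow> K \<subseteq> J \<Longrightarrow> J = K"
      by (rule noetherian_ring.exists_maximal_in_ideal_set[OF noeth ne]) auto
    then have K: "ideal K R" "\<not> good K"
      and max: "\<And>J. ideal J R \<Longrightarrow> K \<subseteq> J \<Longrightarrow> J \<noteq> K \<Longrightarrow> good J"
      by auto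
    interpret K: ideal K R by fact
    have "good (carrier R)"
      unfolding good_def by (rule exI[of _ "{}"]) simp
    then have "carrier R \<noteq> K"
      using K(2) by blast
    have "good K" if "primeideal K R"
    proof -
      have "maximalideal K R"
        using von_neumann_regular_imp_zero_dimensional[OF reg] that
        unfolding zero_dimensional_def by blast
      then show ?thesis
        unfolding good_def using K.a_subset by (intro exI[of _ "{K}"]) auto
    qed
    then have "\<not> primeideal K R"
      using K(2) by blast
    then obtain a b where ab: "a \<in> carrier R" "b \<in> carrier R" "a \<otimes> b \<in> K" "a \<notin> K" "b \<notin> K"
      using primeidealI[OF K(1) is_cring \<open>carrier R \<noteq> K\<close>] by blast
    have good_add: "good (K <+>\<^bsub>R\<^esub> PIdl c)" if c: "c \<in> carrier R" "c \<notin> K" for c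
    proof (rule max)
      show "ideal (K <+>\<^bsub>R\<^esub> PIdl c) R"
        using add_ideals[OF K(1) cgenideal_ideal[OF c(1)]] .
    qed (use subset_add_PIdl[OF K(1) c(1)] c(2) in auto)
    have "z \<in> K" if z: "z \<in> K <+>\<^bsub>R\<^esub> PIdl a" "z \<in> K <+>\<^bsub>R\<^esub> PIdl b" for z
    proof -
      have zc: "z \<in> carrier R"
        using ideal.Icarr[OF add_ideals[OF K(1) cgenideal_ideal[OF ab(1)]] z(1)] .
      obtain x where "x \<in> carrier R" "z = x \<otimes> (z \<otimes> z)"
        using reg zc unfolding von_neumann_regular_def by blast
      then show ?thesis
        using K.I_l_closed[OF add_PIdl_mult_mem[OF K(1) ab(1-3) z]] by metis
    qed
    then have K_eq: "K = (K <+>\<^bsub>R\<^esub> PIdl a) \<inter> (K <+>\<^bsub>R\<^esub> PIdl b)"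
      using subset_add_PIdl(1)[OF K(1)] ab by blast
    obtain Ms where Ms: "finite Ms" "\<forall>M\<in>Ms. maximalideal M R" "K <+>\<^bsub>R\<^esub> PIdl a = carrier R \<inter> \<Inter>Ms"
      using good_add[OF ab(1,4)] unfolding good_def by blast
    obtain Ns where Ns: "finite Ns" "\<forall>M\<in>Ns. maximalideal M R" "K <+>\<^bsub>R\<^esub> PIdl b = carrier R \<inter> \<Inter>Ns"
      using good_add[OF ab(2,5)] unfolding good_def by blast
    have "K = carrier R \<inter> \<Inter>(Ms \<union> Ns)"
      using K_eq Ms(3) Ns(3) by auto
    then have "good K"
      unfolding good_def using Ms Ns by (intro exI[of _ "Ms \<union> Ns"]) auto
    then show False
      using K(2) by blast
  qed
  then show thesis
    using that unfolding good_def by blast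
qed

lemma (in cring) distinct_maximalideals_comaximal:
  assumes M: "maximalideal M R" and N: "maximalideal N R" and ne: "M \<noteq> N"
  shows "M <+>\<^bsub>R\<^esub> N = carrier R"
proof -
  interpret M: maximalideal M R by fact
  interpret N: maximalideal N R by fact
  have sum: "ideal (M <+>\<^bsub>R\<^esub> N) R"
    using add_ideals M.is_ideal N.is_ideal by blast
  note subset_add_ideals[OF M.is_ideal N.is_ideal]
  moreover have "M <+>\<^bsub>R\<^esub> N \<subseteq> carrier R"
    using ideal.Icarr[OF sum] by blast
  ultimately show ?thesis
    using M.I_maximal[OF sum] N.I_maximal[OF sum] ne by auto
qed

text \<open>For \<open>Ms = {}\<close> the ring is zero, that is, the empty product; it is treated separately because
  the Chinese remainder theorem is indexed by the non-empty range \<open>{..n}\<close>.\<close>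

lemma (in cring) finite_product_of_fields_if_Inter_maximalideals:
  assumes fin: "finite Ms" and max: "\<And>M. M \<in> Ms \<Longrightarrow> maximalideal M R"
    and zero: "{\<zero>} = carrier R \<inter> \<Inter>Ms"
  shows "finite_product_of_fields R"
proof (cases "Ms = {}")
  case True
  then have c: "carrier R = {\<zero>}"
    using zero by simp
  have "(\<lambda>x. []) \<in> ring_iso R (RDirProd_list ([] :: 'a ring list))"
    by (rule ring_iso_memI) (auto simp: c monoid.defs intro!: bij_betwI[where g = "\<lambda>x. \<zero>"])
  then have "R \<simeq> RDirProd_list ([] :: 'a ring list)"
    unfolding is_ring_iso_def by blast
  then show ?thesis
    by (rule finite_product_of_fieldsI[rotated]) simp
next
  case False
  obtain Ls where Ls: "set Ls = Ms" "distinct Ls"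
    using finite_distinct_list[OF fin] by blast
  then obtain n where n: "length Ls = Suc n"
    using False by (cases Ls) auto
  have mem: "Ls ! i \<in> Ms" if "i \<le> n" for i
    using that Ls n by (metis le_imp_less_Suc nth_mem)
  have "R Quot (\<Inter>i\<le>n. Ls ! i) \<simeq> RDirProd_list (map (\<lambda>i. R Quot (Ls ! i)) [0..<Suc n])"
  proof (rule chinese_remainder)
    show "ideal (Ls ! i) R" if "i \<le> n" for i
      using max[OF mem[OF that]] by (simp add: maximalideal_def)
    show "Ls ! i <+>\<^bsub>R\<^esub> Ls ! j = carrier R" if "i \<le> n" "j \<le> n" "i \<noteq> j" for i j
    proof (rule distinct_maximalideals_comaximal)
      show "Ls ! i \<noteq> Ls ! j"
        using that n Ls(2) by (simp add: nth_eq_iff_index_eq)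
    qed (use max mem that in auto)
  qed
  moreover have "(\<Inter>i\<le>n. Ls ! i) = \<Inter>Ms"
    unfolding Ls(1)[symmetric] set_conv_nth n by (auto simp: less_Suc_eq_le)
  moreover have "\<Inter>Ms \<subseteq> carrier R"
  proof -
    from False obtain M where M: "M \<in> Ms"
      by blast
    then have "M \<subseteq> carrier R"
      using ideal.Icarr[OF maximalideal.axioms(1)[OF max]] by auto
    with M show ?thesis
      by blast
  qed
  ultimately have "R Quot {\<zero>} \<simeq> RDirProd_list (map (\<lambda>i. R Quot (Ls ! i)) [0..<Suc n])"
    using zero by (simp add: Int_absorb1)
  from ring_iso_trans[OF FactRing_zeroideal(2) this] show ?thesis
  proof (rule finite_product_of_fieldsI[rotated])
    fix F assume "F \<in> set (map (\<lambda>i. R Quot (Ls ! i)) [0..<Suc n])"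
    then obtain i where "i \<in> set [0..<Suc n]" "F = R Quot (Ls ! i)"
      unfolding set_map by (rule imageE)
    then have i: "i \<le> n" "F = R Quot (Ls ! i)"
      by auto
    then show "field F"
      using maximalideal.quotient_is_field[OF max[OF mem] is_cring] by simp
  qed
qed

section \<open>Regularity of products of fields\<close>

lemma (in field) von_neumann_regular: "von_neumann_regular R"
  unfolding von_neumann_regular_def
proof
  fix f assume f: "f \<in> carrier R"
  show "\<exists>x\<in>carrier R. f = x \<otimes> (f \<otimes> f)"
  proof (cases "f = \<zero>")
    case True
    then show ?thesis by (intro bexI[of _ \<zero>]) auto
  next
    case False
    then have "f \<in> Units R"
      using f field_Units by blast
    then have "inv f \<in> carrier R" "f = inv f \<otimes> (f \<otimes> f)"
      using f by (simp_all flip: m_assoc)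
    then show ?thesis by blast
  qed
qed

lemma (in ring) von_neumann_regular_iso:
  assumes iso: "R \<simeq> S" and reg: "von_neumann_regular S"
  shows "von_neumann_regular R"
  unfolding von_neumann_regular_def
proof
  obtain h where h: "h \<in> ring_iso R S"
    using iso unfolding is_ring_iso_def by blast
  note hom = ring_iso_memE[OF h]
  fix f assume f: "f \<in> carrier R"
  obtain y where y: "y \<in> carrier S" "h f = y \<otimes>\<^bsub>S\<^esub> (h f \<otimes>\<^bsub>S\<^esub> h f)"
    using reg hom(1)[OF f] unfolding von_neumann_regular_def by blast
  obtain x where x: "x \<in> carrier R" "y = h x"
    using hom(5) y(1) unfolding bij_betw_def by blast
  have "h f = h (x \<otimes> (f \<otimes> f))"
    using y(2) x f hom(2) by simp
  then have "f = x \<otimes> (f \<otimes> f)"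
    using hom(5) x f unfolding bij_betw_def inj_on_def by simp
  then show "\<exists>x\<in>carrier R. f = x \<otimes> (f \<otimes> f)"
    using x by blast
qed

lemma von_neumann_regular_RDirProd:
  assumes "von_neumann_regular R" "von_neumann_regular S"
  shows "von_neumann_regular (RDirProd R S)"
  using assms unfolding von_neumann_regular_def
  by (fastforce simp: RDirProd_def DirProd_def monoid.defs)

lemma von_neumann_regular_RDirProd_list:
  assumes "\<And>F. F \<in> set Fs \<Longrightarrow> ring F" "\<And>F. F \<in> set Fs \<Longrightarrow> von_neumann_regular F"
  shows "von_neumann_regular (RDirProd_list Fs)"
  using assms
proof (induction Fs)
  case Nil
  show ?case
    by (simp add: von_neumann_regular_def monoid.defs)
next
  case (Cons F Fs)
  have "ring (RDirProd_list (F # Fs))"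
    by (rule RDirProd_list_is_ring) (use Cons.prems(1) nth_mem in metis)
  moreover have "RDirProd_list (F # Fs) \<simeq> RDirProd F (RDirProd_list Fs)"
    using RDirProd_list_iso2 unfolding is_ring_iso_def by blast
  moreover have "von_neumann_regular (RDirProd F (RDirProd_list Fs))"
    by (rule von_neumann_regular_RDirProd) (use Cons in auto)
  ultimately show ?case
    by (rule ring.von_neumann_regular_iso)
qed

lemma (in ring) finite_product_of_fields_imp_von_neumann_regular:
  assumes "finite_product_of_fields R"
  shows "von_neumann_regular R"
proof -
  obtain Fs :: "'a ring list" where Fs: "\<And>F. F \<in> set Fs \<Longrightarrow> field F" "R \<simeq> RDirProd_list Fs"
    using assms unfolding finite_product_of_fields_def by blast
  have "von_neumann_regular (RDirProd_list Fs)"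
    by (rule von_neumann_regular_RDirProd_list)
      (use Fs(1) field.von_neumann_regular in \<open>auto simp: field_def domain_def cring_def\<close>)
  with Fs(2) show ?thesis
    by (rule von_neumann_regular_iso)
qed

theorem proposition3p3:
  fixes R (structure)
  assumes "cring R"
  shows "(reduced_ring R \<and> zero_dimensional R \<longleftrightarrow>
            (\<forall>f\<in>carrier R. f \<in> PIdl (f [^] (2::nat)))) \<and>
         (noetherian_ring R \<longrightarrow>
            ((\<forall>f\<in>carrier R. f \<in> PIdl (f [^] (2::nat))) \<longleftrightarrow> finite_product_of_fields R))"
proof -
  interpret cring R by fact
  have "finite_product_of_fields R" if "noetherian_ring R" "von_neumann_regular R"
    using ideal_finite_Inter_maximalideals[OF that zeroideal]
      finite_product_of_fields_if_Inter_maximalideals by metis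
  then show ?thesis
    unfolding von_neumann_regular_iff_mem_PIdl_square[symmetric]
    using von_neumann_regular_imp_reduced von_neumann_regular_imp_zero_dimensional
      reduced_zero_dimensional_imp_von_neumann_regular
      finite_product_of_fields_imp_von_neumann_regular by blast
qed

end
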